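(* There exists a uniquely ergodic affine interval exchange transformation $T$ of $[0,1]$ with flips such that $T$ has wandering intervals and the support of the invariant measure of $T$ is a Cantor set.
   Context: Affine interval exchange transformations. Let $0\le a<b$ and let $D$ be a finite set with $\{a,b\}\subset D\subset[a,b]$, $D=\{x_0,\ldots,x_n\}$, $a=x_0<x_1<\cdots<x_n=b$. An affine interval exchange transformation of $n$ subintervals ($n$-AIET) of $[a,b]$, written $T:[a,b]\to[a,b]$, is an injective, continuously differentiable map with values in $[a,b]$ defined on $\mathcal{D}(T)=[a,b]\setminus D$, such that $|DT|$ is a positive, locally constant function ($DT$ denotes the derivative of $T$), such that the image of $T$ is all of $[a,b]$ except for finitely many points, and such that the points of $D\setminus\{a,b\}$ are non-removable discontinuities of $T$. An affine interval exchange transformation (AIET) is an $n$-AIET for some $n$. An AIET is oriented if $DT>0$ everywhere on $\mathcal{D}(T)$; otherwise it has flips. Wandering intervals. A subinterval $J\subset[a,b]$ is a wandering interval of $T$ if the forward iterates $T^m(J)$, $m=0,1,2,\ldots$, are pairwise disjoint intervals, each not reduced to a point, and the $\omega$-limit set of $J$ is an infinite set. Unique ergodicity. $T$ is uniquely ergodic if it has exactly one invariant Borel probability measure, where $\mu$ is invariant if $\mu(T^{-1}(B))=\mu(B)$ for every Borel set $B\subset[a,b]$, with $T^{-1}(B)=\{x\in\mathcal{D}(T): T(x)\in B\}$. "The invariant measure" is this unique measure. A Cantor set is a nonempty compact, perfect, totally disconnected subset of $\mathbb{R}$. *)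

theory Defs
  imports "HOL-Probability.Probability"
begin

(* An exchange map is a partial map on [a,b], defined off the finite set D.  It is represented
   by D together with a total function T :: real => real; only the values of T on
   aiet_dom a b D are ever used. *)
definition aiet_dom :: "real \<Rightarrow> real \<Rightarrow> real set \<Rightarrow> real set" where
  "aiet_dom a b D = {a..b} - D"

(* aiet_dom a b D is open, so deriv T and the two-sided C1_differentiable_on do not depend
   on the values of T on D or outside [a,b]. *)
definition n_AIET :: "nat \<Rightarrow> real \<Rightarrow> real \<Rightarrow> real set \<Rightarrow> (real \<Rightarrow> real) \<Rightarrow> bool" where
  "n_AIET n a b D T \<longleftrightarrow>
     0 \<le> a \<and> a < b \<and>
     finite D \<and> {a, b} \<subseteq> D \<and> D \<subseteq> {a..b} \<and> card D = n + 1 \<and>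
     inj_on T (aiet_dom a b D) \<and>
     T ` aiet_dom a b D \<subseteq> {a..b} \<and>
     T C1_differentiable_on aiet_dom a b D \<and>
     (\<forall>x\<in>aiet_dom a b D. 0 < \<bar>deriv T x\<bar>) \<and>
     (\<forall>x\<in>aiet_dom a b D. \<exists>U. openin (top_of_set (aiet_dom a b D)) U \<and> x \<in> U \<and>
        (\<lambda>y. \<bar>deriv T y\<bar>) constant_on U) \<and>
     finite ({a..b} - T ` aiet_dom a b D) \<and>
     (\<forall>x\<in>D - {a, b}. \<not> (\<exists>l. (T \<longlongrightarrow> l) (at x within aiet_dom a b D)))"

definition AIET :: "real \<Rightarrow> real \<Rightarrow> real set \<Rightarrow> (real \<Rightarrow> real) \<Rightarrow> bool" where
  "AIET a b D T \<longleftrightarrow> (\<exists>n. n_AIET n a b D T)"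

definition oriented :: "real \<Rightarrow> real \<Rightarrow> real set \<Rightarrow> (real \<Rightarrow> real) \<Rightarrow> bool" where
  "oriented a b D T \<longleftrightarrow> (\<forall>x\<in>aiet_dom a b D. 0 < deriv T x)"

definition has_flips :: "real \<Rightarrow> real \<Rightarrow> real set \<Rightarrow> (real \<Rightarrow> real) \<Rightarrow> bool" where
  "has_flips a b D T \<longleftrightarrow> \<not> oriented a b D T"

(* The image of J under the m-th iterate of the partial map: points whose orbit meets D are
   dropped from the moment they do. *)
definition forward_image ::
    "real \<Rightarrow> real \<Rightarrow> real set \<Rightarrow> (real \<Rightarrow> real) \<Rightarrow> nat \<Rightarrow> real set \<Rightarrow> real set" where
  "forward_image a b D T m J = ((\<lambda>S. T ` (S \<inter> aiet_dom a b D)) ^^ m) J"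

definition omega_limit :: "real \<Rightarrow> real \<Rightarrow> real set \<Rightarrow> (real \<Rightarrow> real) \<Rightarrow> real set \<Rightarrow> real set" where
  "omega_limit a b D T J = (\<Inter>k. closure (\<Union>m\<in>{k..}. forward_image a b D T m J))"

definition wandering_interval ::
    "real \<Rightarrow> real \<Rightarrow> real set \<Rightarrow> (real \<Rightarrow> real) \<Rightarrow> real set \<Rightarrow> bool" where
  "wandering_interval a b D T J \<longleftrightarrow>
     J \<subseteq> {a..b} \<and>
     (\<forall>m. is_interval (forward_image a b D T m J) \<and>
          (\<exists>x\<in>forward_image a b D T m J. \<exists>y\<in>forward_image a b D T m J. x \<noteq> y)) \<and>
     disjoint_family (\<lambda>m. forward_image a b D T m J) \<and>
     infinite (omega_limit a b D T J)"

definition invariant_prob ::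
    "real \<Rightarrow> real \<Rightarrow> real set \<Rightarrow> (real \<Rightarrow> real) \<Rightarrow> real measure \<Rightarrow> bool" where
  "invariant_prob a b D T M \<longleftrightarrow>
     sets M = sets (restrict_space borel {a..b}) \<and> prob_space M \<and>
     (\<forall>B\<in>sets M. emeasure M {x \<in> aiet_dom a b D. T x \<in> B} = emeasure M B)"

definition uniquely_ergodic :: "real \<Rightarrow> real \<Rightarrow> real set \<Rightarrow> (real \<Rightarrow> real) \<Rightarrow> bool" where
  "uniquely_ergodic a b D T \<longleftrightarrow> (\<exists>!M. invariant_prob a b D T M)"

(* Meaningful only under uniquely_ergodic a b D T. *)
definition the_invariant_measure ::
    "real \<Rightarrow> real \<Rightarrow> real set \<Rightarrow> (real \<Rightarrow> real) \<Rightarrow> real measure" where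
  "the_invariant_measure a b D T = (THE M. invariant_prob a b D T M)"

(* M lives on a subspace of the reals, hence the intersection with space M. *)
definition measure_support :: "real measure \<Rightarrow> real set" where
  "measure_support M = {x \<in> space M. \<forall>U. open U \<longrightarrow> x \<in> U \<longrightarrow> 0 < emeasure M (U \<inter> space M)}"

definition cantor_set :: "real set \<Rightarrow> bool" where
  "cantor_set C \<longleftrightarrow>
     C \<noteq> {} \<and> compact C \<and> {x. x islimpt C} = C \<and>
     (\<forall>S. S \<subseteq> C \<longrightarrow> connected S \<longrightarrow> S \<noteq> {} \<longrightarrow> (\<exists>x. S = {x}))"

end

theory Submission
  imports Defs "HOL-Analysis.Kronecker_Approximation_Theorem"
begin

text \<open>
  On \<open>[0,1/2]\<close> take a contracted rotation: an injective map with two increasing branches of slope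
  \<open>1/2\<close>, obtained from the rotation by an irrational \<open>\<alpha>\<close> by blowing up the forward orbit of the
  discontinuity into gaps \<open>gap n\<close> whose lengths halve at each step.  Each gap is mapped onto the next,
  so they wander, and they fill \<open>[0,1/2]\<close> up to a null set.  The part of \<open>[0,1/2]\<close> missed by the
  map is \<open>gap 0\<close>; it is supplied by a flipped branch on \<open>(1/2,3/4)\<close>, while \<open>(3/4,1)\<close> is
  stretched onto \<open>(1/2,1)\<close>.  An invariant probability gives no mass to \<open>(1/2,1)\<close> or to the gaps,
  and it has no atoms: the atoms of maximal mass would form a finite invariant set, making \<open>\<alpha>\<close>
  rational.  Its distribution function semiconjugates the map to a rotation whose number can be
  read off the itinerary of the gaps; hence it is determined on the dense set of gaps, which gives
  uniqueness.  The support is perfect as there are no atoms and totally disconnected as the gaps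
  are dense and null.
\<close>

section \<open>Blowing up an orbit of an irrational rotation\<close>

locale irrational_rotation =
  fixes \<alpha> :: real
  assumes alpha_pos: "0 < \<alpha>" and alpha_less_1: "\<alpha> < 1" and alpha_irrational: "\<alpha> \<notin> \<rat>"
begin

text \<open>The forward orbit of 0 under the rotation starts at \<open>p 0 = \<alpha>\<close>; its \<open>n\<close>-th point is blown up
  to an interval of length \<open>w n\<close>.  The lengths are chosen to add up to \<open>1/2\<close>, so that the image of
  \<open>\<phi>\<close> has measure zero.\<close>

definition p :: "nat \<Rightarrow> real" where
  "p n = frac (real (Suc n) * \<alpha>)"

definition w :: "nat \<Rightarrow> real" where
  "w n = (1/2) ^ (n + 2)"

definition \<phi> :: "real \<Rightarrow> real" where
  "\<phi> t = (\<Sum>n. if p n < t then w n else 0)"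

text \<open>The rotation breaks at \<open>1 - \<alpha>\<close>, which the orbit \<open>p\<close>
  never visits; its image is the break of the contracted rotation.\<close>

definition \<theta> :: real where
  "\<theta> = \<phi> (1 - \<alpha>)"

text \<open>The strict inequality in \<open>\<phi>\<close> makes \<open>\<phi> (p n)\<close> the
  lower end of the jump of size \<open>w n\<close> at \<open>p n\<close>; this is the open interval
  jumped over.\<close>

definition gap :: "nat \<Rightarrow> real set" where
  "gap n = {\<phi> (p n)<..<\<phi> (p n) + w n}"

section \<open>The rotation orbit and the weights\<close>

lemma w_pos: "0 < w n"
  by (simp add: w_def)

lemma w_Suc: "w (Suc n) = w n / 2"
  by (simp add: w_def)

lemma w_0: "w 0 = 1/4"
  by (simp add: w_def power2_eq_square)

lemma w_sums: "w sums (1/2)"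
proof -
  have "(\<lambda>n. (1/4) * (1/2::real) ^ n) sums ((1/4) * (1 / (1 - 1/2)))"
    by (intro sums_mult geometric_sums) simp
  then show ?thesis
    by (simp add: w_def[abs_def] power2_eq_square mult.commute power_add)
qed

lemma p_0: "p 0 = \<alpha>"
  using alpha_pos alpha_less_1 by (simp add: p_def frac_eq)

text \<open>The arithmetic form of irrationality: it keeps the orbit off 0, makes \<open>p\<close>
  injective and later excludes finite invariant sets.\<close>

lemma mult_alpha_eq_of_int:
  assumes "of_int j * \<alpha> = of_int m"
  shows "j = 0"
proof (rule ccontr)
  assume "j \<noteq> 0"
  then have "\<alpha> = of_int m / of_int j"
    using assms by (simp add: field_simps)
  then show False
    using alpha_irrational by (metis Rats_divide Rats_of_int)
qed

lemma p_pos: "0 < p n"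
proof -
  have "real (Suc n) * \<alpha> \<notin> \<int>"
    using mult_alpha_eq_of_int[of "int (Suc n)"] by (auto elim!: Ints_cases)
  then show ?thesis
    by (simp add: p_def frac_gt_0_iff)
qed

lemma p_less_1: "p n < 1"
  by (simp add: p_def frac_lt_1)

lemma p_Suc: "p (Suc n) = (if p n < 1 - \<alpha> then p n + \<alpha> else p n + \<alpha> - 1)"
proof -
  have "p (Suc n) = frac (real (Suc n) * \<alpha> + \<alpha>)"
    by (simp add: p_def algebra_simps)
  moreover have "frac \<alpha> = \<alpha>"
    using alpha_pos alpha_less_1 by (simp add: frac_eq)
  ultimately show ?thesis
    by (auto simp: frac_add p_def)
qed

lemma p_neq_one_minus_alpha: "p n \<noteq> 1 - \<alpha>"
  using p_Suc[of n] p_pos[of "Suc n"] by auto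

lemma inj_p: "inj p"
proof (rule injI)
  fix m n assume "p m = p n"
  then have "of_int (int m - int n) * \<alpha> = of_int (\<lfloor>real (Suc m) * \<alpha>\<rfloor> - \<lfloor>real (Suc n) * \<alpha>\<rfloor>)"
    by (simp add: p_def frac_def algebra_simps)
  from mult_alpha_eq_of_int[OF this] show "m = n"
    by simp
qed

text \<open>Kronecker's theorem, with the midpoint as target and half the length as tolerance. It
  supplies a positive multiple, which fits the indexing of \<open>p\<close> by
  \<open>Suc n\<close>.\<close>

lemma p_dense:
  assumes "0 \<le> s" "s < t" "t \<le> 1"
  obtains n where "s < p n" "p n < t"
proof -
  obtain k where "k > 0" and k: "\<bar>frac (real k * \<alpha>) - (s + t) / 2\<bar> < (t - s) / 2"
    using Kronecker_approx_1_explicit[OF alpha_irrational, of "(s + t) / 2" "(t - s) / 2"] assms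
    by (auto simp: field_simps)
  from \<open>k > 0\<close> obtain n where "k = Suc n"
    by (metis gr0_implies_Suc)
  with k have "\<bar>p n - (s + t) / 2\<bar> < (t - s) / 2"
    by (simp add: p_def)
  then have "s < p n" "p n < t"
    by (auto simp: abs_if field_simps split: if_splits)
  then show ?thesis
    by (rule that)
qed

section \<open>The blow-up function and its scaling identities\<close>

lemma summable_w_if: "summable (\<lambda>n. if P n then w n else 0)"
  by (rule summable_comparison_test'[OF sums_summable[OF w_sums], of 0])
     (auto simp: less_imp_le[OF w_pos])

lemma phi_mono: "s \<le> t \<Longrightarrow> \<phi> s \<le> \<phi> t"
  unfolding \<phi>_def
  by (intro suminf_le summable_w_if) (auto simp: less_imp_le[OF w_pos])

text \<open>Compare the series termwise: the term of index \<open>n\<close> is absent from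
  \<open>\<phi> s\<close> and present in \<open>\<phi> t\<close>.\<close>

lemma phi_add_w_le:
  assumes "s \<le> p n" "p n < t"
  shows "\<phi> s + w n \<le> \<phi> t"
proof -
  have "\<phi> s + w n = (\<Sum>m. (if p m < s then w m else 0) + (if m = n then w m else 0))"
    unfolding \<phi>_def
    by (subst suminf_add[symmetric]) (auto intro: summable_w_if simp: sums_unique[OF sums_single, symmetric])
  also have "\<dots> \<le> \<phi> t"
    unfolding \<phi>_def using assms
    by (intro suminf_le summable_add summable_w_if) (auto simp: less_imp_le[OF w_pos])
  finally show ?thesis .
qed

lemma phi_strict_mono:
  assumes "0 \<le> s" "s < t" "t \<le> 1"
  shows "\<phi> s < \<phi> t"
proof -
  obtain n where "s < p n" "p n < t"
    using p_dense[OF assms] .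
  then show ?thesis
    using phi_add_w_le[of s n t] w_pos[of n] by simp
qed

lemma phi_less_iff:
  assumes "s \<in> {0..1}" "t \<in> {0..1}"
  shows "\<phi> s < \<phi> t \<longleftrightarrow> s < t"
  using assms phi_strict_mono[of s t] phi_mono[of t s] by force

lemma phi_0: "\<phi> 0 = 0"
proof -
  have "\<not> p n < 0" for n
    using p_pos[of n] by simp
  then show ?thesis
    by (simp add: \<phi>_def)
qed

lemma phi_1: "\<phi> 1 = 1/2"
  using p_less_1 w_sums by (simp add: \<phi>_def sums_unique[symmetric])

lemma phi_bounds:
  assumes "t \<in> {0<..<1}"
  shows "0 < \<phi> t" "\<phi> t < 1/2"
  using phi_strict_mono[of 0 t] phi_strict_mono[of t 1] assms by (auto simp: phi_0 phi_1)

lemma theta_pos: "0 < \<theta>" and theta_less_half: "\<theta> < 1/2"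
  unfolding \<theta>_def using phi_bounds[of "1 - \<alpha>"] alpha_pos alpha_less_1 by simp_all

text \<open>Since \<open>w (Suc n) = w n / 2\<close>, shifting the index by one turns the rotation of the argument of
  \<open>\<phi>\<close> into an affine contraction of its value.\<close>

lemma suminf_w_if_p_Suc:
  "(\<Sum>n. if P (p n) then w n else 0) =
     (if P \<alpha> then 1/4 else 0) + (\<Sum>n. if P (p (Suc n)) then w n else 0) / 2"
proof -
  have "(\<Sum>n. if P (p n) then w n else 0) =
      (if P (p 0) then w 0 else 0) + (\<Sum>n. if P (p (Suc n)) then w (Suc n) else 0)"
    using suminf_split_head[OF summable_w_if[of "\<lambda>n. P (p n)"]] by simp
  also have "(\<Sum>n. if P (p (Suc n)) then w (Suc n) else 0) =
      (\<Sum>n. (if P (p (Suc n)) then w n else 0) / 2)"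
    by (intro suminf_cong) (simp add: w_Suc)
  also have "\<dots> = (\<Sum>n. if P (p (Suc n)) then w n else 0) / 2"
    by (intro suminf_divide summable_w_if)
  finally show ?thesis
    by (simp add: p_0 w_0)
qed

lemma suminf_w_not_less: "(\<Sum>n. if p n < s then 0 else w n) = 1/2 - \<phi> s"
proof -
  have "(\<Sum>n. if p n < s then 0 else w n) = (\<Sum>n. w n - (if p n < s then w n else 0))"
    by (intro suminf_cong) simp
  also have "\<dots> = 1/2 - \<phi> s"
    unfolding \<phi>_def using w_sums
    by (subst suminf_diff[symmetric]) (auto intro: summable_w_if sums_summable simp: sums_unique[symmetric])
  finally show ?thesis .
qed

lemma phi_add_alpha:
  assumes "0 < t" "t \<le> 1 - \<alpha>"
  shows "\<phi> (t + \<alpha>) = (\<phi> t + 1 - \<theta>) / 2"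
proof -
  \<comment> \<open>Points at or beyond \<open>1 - \<alpha>\<close> wrap round to below
    \<open>\<alpha>\<close>, hence always count; the others count exactly when
    \<open>p n < t\<close>.\<close>
  have *: "(if p (Suc n) < t + \<alpha> then w n else 0) =
      (if p n < t then w n else 0) + (if p n < 1 - \<alpha> then 0 else w n)" for n
    using assms p_less_1[of n] by (auto simp: p_Suc)
  have "(\<lambda>n. if p n < 1 - \<alpha> then 0 else w n) = (\<lambda>n. if \<not> p n < 1 - \<alpha> then w n else 0)"
    by auto
  then have "summable (\<lambda>n. if p n < 1 - \<alpha> then 0 else w n)"
    using summable_w_if by metis
  then have "(\<Sum>n. if p (Suc n) < t + \<alpha> then w n else 0) = \<phi> t + (1/2 - \<theta>)"
    unfolding * \<theta>_def suminf_w_not_less[symmetric]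
    by (subst suminf_add[symmetric]) (auto intro: summable_w_if simp: \<phi>_def)
  then show ?thesis
    using assms suminf_w_if_p_Suc[of "\<lambda>x. x < t + \<alpha>"] by (simp add: \<phi>_def field_simps)
qed

lemma phi_add_alpha_minus_1:
  assumes "1 - \<alpha> \<le> t" "t \<le> 1"
  shows "\<phi> (t + \<alpha> - 1) = (\<phi> t - \<theta>) / 2"
proof -
  \<comment> \<open>Only wrapped points can land below \<open>t + \<alpha> - 1\<close>, which is at
    most \<open>\<alpha>\<close>; they come from \<open>1 - \<alpha> \<le> p n < t\<close>.\<close>
  have *: "(if p (Suc n) < t + \<alpha> - 1 then w n else 0) =
      (if p n < t then w n else 0) - (if p n < 1 - \<alpha> then w n else 0)" for n
    using assms p_pos[of n] by (auto simp: p_Suc)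
  have "(\<Sum>n. if p (Suc n) < t + \<alpha> - 1 then w n else 0) = \<phi> t - \<theta>"
    unfolding * \<theta>_def \<phi>_def
    by (subst suminf_diff[symmetric]) (auto intro: summable_w_if)
  then show ?thesis
    using assms suminf_w_if_p_Suc[of "\<lambda>x. x < t + \<alpha> - 1"] by (simp add: \<phi>_def)
qed

text \<open>The rotation sends 1 to \<open>\<alpha>\<close>. As \<open>w 0\<close> is 1/4,
  \<open>gap 0\<close> runs from \<open>1/4 - \<theta> / 2\<close> to
  \<open>1/2 - \<theta> / 2\<close>, the stretch that the flipped branch has to cover.\<close>

lemma phi_alpha: "\<phi> \<alpha> = 1/4 - \<theta> / 2"
  using phi_add_alpha_minus_1[of 1] alpha_pos by (simp add: phi_1)

lemma phi_p_Suc: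
  "\<phi> (p (Suc n)) = (if p n < 1 - \<alpha> then (\<phi> (p n) + 1 - \<theta>) / 2 else (\<phi> (p n) - \<theta>) / 2)"
  using phi_add_alpha[of "p n"] phi_add_alpha_minus_1[of "p n"] p_pos[of n] p_less_1[of n]
  by (auto simp: p_Suc)

section \<open>Disjointness, position and density of the gaps\<close>

lemma gap_less:
  assumes "p m < p n"
  shows "\<phi> (p m) + w m \<le> \<phi> (p n)"
  using phi_add_w_le[of "p m" m "p n"] assms by simp

lemma disjoint_gaps: "disjoint_family gap"
  unfolding disjoint_family_on_def
proof (intro ballI impI)
  fix m n :: nat assume "m \<noteq> n"
  then have "p m < p n \<or> p n < p m"
    using inj_p by (metis injD linorder_neqE)
  then show "gap m \<inter> gap n = {}"
    using gap_less[of m n] gap_less[of n m] by (force simp: gap_def)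
qed

text \<open>A jump on one side of \<open>1 - \<alpha>\<close> is completed on that side. Hence each
  gap lies in a single branch of the map.\<close>

lemma gap_subset_side:
  "gap n \<subseteq> (if p n < 1 - \<alpha> then {0<..<\<theta>} else {\<theta><..<1/2})"
proof (cases "p n < 1 - \<alpha>")
  case True
  then have "\<phi> (p n) + w n \<le> \<theta>"
    unfolding \<theta>_def by (intro phi_add_w_le) auto
  then show ?thesis
    using True phi_bounds[of "p n"] p_pos[of n] p_less_1[of n] by (auto simp: gap_def)
next
  case False
  then have "\<theta> \<le> \<phi> (p n)"
    unfolding \<theta>_def by (intro phi_mono) simp
  moreover have "\<phi> (p n) + w n \<le> \<phi> 1"
    using p_less_1[of n] by (intro phi_add_w_le) auto
  ultimately show ?thesis
    using False by (auto simp: gap_def phi_1)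
qed

lemma gap_subset: "gap n \<subseteq> {0<..<1/2} - {\<theta>}"
  using gap_subset_side[of n] theta_pos theta_less_half by (auto split: if_splits)

lemma open_gap: "open (gap n)"
  by (simp add: gap_def)

lemma emeasure_gap: "emeasure lborel (gap n) = ennreal (w n)"
  using less_imp_le[OF w_pos[of n]] by (simp add: gap_def)

text \<open>The gaps have total length 1/2, the length of \<open>{0<..<1/2}\<close>; an open set
  inside it that misses all of them would have measure 0.\<close>

lemma gaps_dense:
  assumes "open U" "U \<inter> {0..1/2} \<noteq> {}"
  obtains n where "U \<inter> gap n \<noteq> {}"
proof -
  have "{0<..<1/2::real} \<inter> U \<noteq> {}"
  proof -
    have "closure {0<..<1/2::real} = {0..1/2}"
      by simp
    then show ?thesis
      using assms open_Int_closure_eq_empty[of U "{0<..<1/2::real}"] by auto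
  qed
  then have ne: "U \<inter> {0<..<1/2} \<noteq> {}" "open (U \<inter> {0<..<1/2})"
    using assms by auto
  have "emeasure lborel (\<Union>n. gap n) = (\<Sum>n. ennreal (w n))"
    by (subst suminf_emeasure[symmetric])
       (auto simp: emeasure_gap disjoint_gaps intro!: borel_open open_gap)
  also have "\<dots> = ennreal (1/2)"
    using suminf_ennreal2[OF less_imp_le[OF w_pos] sums_summable[OF w_sums]]
    unfolding sums_unique[OF w_sums, symmetric] .
  finally have total: "emeasure lborel (\<Union>n. gap n) = ennreal (1/2)" .
  have "\<exists>n. U \<inter> gap n \<noteq> {}"
  proof (rule ccontr)
    assume "\<not> (\<exists>n. U \<inter> gap n \<noteq> {})"
    then have disj: "(U \<inter> {0<..<1/2}) \<inter> (\<Union>n. gap n) = {}"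
      by auto
    have "emeasure lborel (U \<inter> {0<..<1/2}) + ennreal (1/2) =
        emeasure lborel ((U \<inter> {0<..<1/2}) \<union> (\<Union>n. gap n))"
      unfolding total[symmetric] using ne disj
      by (intro plus_emeasure) (auto intro!: borel_open open_gap)
    also have "\<dots> \<le> emeasure lborel {0<..<1/2::real}"
      using gap_subset by (intro emeasure_mono) auto
    also have "\<dots> = ennreal (1/2)"
      by simp
    finally have "ennreal (1/2) + emeasure lborel (U \<inter> {0<..<1/2}) \<le> ennreal (1/2) + 0"
      by (simp only: add.commute add_0)
    then have "emeasure lborel (U \<inter> {0<..<1/2}) = 0"
      unfolding ennreal_add_left_cancel_le by simp
    moreover obtain x where x: "x \<in> U \<inter> {0<..<1/2}"
      using ne by blast
    then obtain e where xe: "0 < e" "ball x e \<subseteq> U \<inter> {0<..<1/2}"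
      using ne(2) open_contains_ball by metis
    moreover have "emeasure lborel (ball x e) \<le> emeasure lborel (U \<inter> {0<..<1/2})"
      using xe ne by (intro emeasure_mono) auto
    ultimately show False
      using \<open>0 < e\<close> by (simp add: ball_eq_greaterThanLessThan)
  qed
  then show ?thesis
    using that by blast
qed

end

section \<open>The exchange map\<close>

text \<open>\<open>f\<close> and \<open>g\<close> stand for continuous extensions of the two
  adjacent branches; a limit of \<open>h\<close> would have to equal both of their values at
  \<open>x\<close>.\<close>

lemma no_limit_if_one_sided_limits_differ:
  fixes f g h :: "real \<Rightarrow> real"
  assumes "a < x" "x < b" "{a<..<b} - {x} \<subseteq> S"
    and f: "\<And>y. a < y \<Longrightarrow> y < x \<Longrightarrow> h y = f y" "isCont f x"
    and g: "\<And>y. x < y \<Longrightarrow> y < b \<Longrightarrow> h y = g y" "isCont g x"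
    and "f x \<noteq> g x"
  shows "\<not> (\<exists>l. (h \<longlongrightarrow> l) (at x within S))"
proof
  assume "\<exists>l. (h \<longlongrightarrow> l) (at x within S)"
  then obtain l where l: "(h \<longlongrightarrow> l) (at x within S)" ..
  have *: "l = k x" if "A \<subseteq> S" "\<And>y. y \<in> A \<Longrightarrow> h y = k y" "isCont k x" "x islimpt A" for k A
  proof (rule tendsto_unique)
    show "at x within A \<noteq> bot"
      using that by (simp add: trivial_limit_within)
    have "(h \<longlongrightarrow> l) (at x within A)"
      using l \<open>A \<subseteq> S\<close> by (rule tendsto_within_subset)
    moreover have "\<forall>\<^sub>F y in at x within A. h y = k y"
      using that by (simp add: eventually_at_filter)
    ultimately show "(k \<longlongrightarrow> l) (at x within A)"
      by (simp cong: tendsto_cong)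
    show "(k \<longlongrightarrow> k x) (at x within A)"
      using \<open>isCont k x\<close> continuous_at_imp_continuous_at_within continuous_within by blast
  qed
  have "l = f x"
    using assms by (intro *[of "{a<..<x}"]) (auto intro: islimpt_greaterThanLessThan2)
  moreover have "l = g x"
    using assms by (intro *[of "{x<..<b}"]) (auto intro: islimpt_greaterThanLessThan1)
  ultimately show False
    using \<open>f x \<noteq> g x\<close> by simp
qed

context irrational_rotation
begin

definition D :: "real set" where
  "D = {0, \<theta>, 1/2, 3/4, 1}"

text \<open>The first two branches form the contracted rotation.  The third one covers the gap
  that it leaves in \<open>[0,1/2]\<close>, with a flip, and the fourth one expands away from the fixed point 1,
  which carries no invariant mass because it lies in \<open>D\<close>.\<close>

definition T :: "real \<Rightarrow> real" where
  "T x = (if x < \<theta> then (x + 1 - \<theta>) / 2 else if x < 1/2 then (x - \<theta>) / 2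
          else if x < 3/4 then 1 - \<theta> / 2 - x else 2 * x - 1)"

definition slope :: "real \<Rightarrow> real" where
  "slope x = (if x < 1/2 then 1/2 else if x < 3/4 then -1 else 2)"

abbreviation dom :: "real set" where
  "dom \<equiv> aiet_dom 0 1 D"

lemma dom_eq: "dom = {0<..<\<theta>} \<union> {\<theta><..<1/2} \<union> {1/2<..<3/4} \<union> {3/4<..<1}"
  using theta_pos theta_less_half by (auto simp: aiet_dom_def D_def)

lemma open_dom: "open dom"
  unfolding dom_eq by (intro open_Un open_greaterThanLessThan)

text \<open>The derivative, the continuity of the slope and its local constancy all follow from this
  one case distinction.\<close>

lemma locally_affine:
  assumes "x \<in> dom"
  obtains U b where "open U" "x \<in> U" "U \<subseteq> dom"
    "\<And>y. y \<in> U \<Longrightarrow> T y = slope x * y + b" "\<And>y. y \<in> U \<Longrightarrow> slope y = slope x"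
proof -
  from assms consider "x \<in> {0<..<\<theta>}" | "x \<in> {\<theta><..<1/2}" | "x \<in> {1/2<..<3/4}" | "x \<in> {3/4<..<1}"
    unfolding dom_eq by blast
  then show ?thesis
  proof cases
    case 1
    then show ?thesis
      using theta_less_half
      by (intro that[of "{0<..<\<theta>}" "(1 - \<theta>) / 2"]) (auto simp: dom_eq T_def slope_def field_simps)
  next
    case 2
    then show ?thesis
      by (intro that[of "{\<theta><..<1/2}" "- \<theta> / 2"]) (auto simp: dom_eq T_def slope_def field_simps)
  next
    case 3
    then show ?thesis
      using theta_less_half
      by (intro that[of "{1/2<..<3/4}" "1 - \<theta> / 2"]) (auto simp: dom_eq T_def slope_def field_simps)
  next
    case 4
    then show ?thesis
      using theta_less_half
      by (intro that[of "{3/4<..<1}" "- 1"]) (auto simp: dom_eq T_def slope_def field_simps)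
  qed
qed

lemma T_has_derivative:
  assumes "x \<in> dom"
  shows "(T has_field_derivative slope x) (at x)"
proof -
  obtain U b where U: "open U" "x \<in> U" "\<And>y. y \<in> U \<Longrightarrow> T y = slope x * y + b"
    using locally_affine[OF assms] by metis
  have "((\<lambda>y. slope x * y + b) has_field_derivative slope x) (at x)"
    by (auto intro!: derivative_eq_intros)
  then show ?thesis
    by (rule has_field_derivative_transform_within_open[OF _ U(1,2)]) (simp add: U(3))
qed

lemma deriv_T: "x \<in> dom \<Longrightarrow> deriv T x = slope x"
  by (intro DERIV_imp_deriv T_has_derivative)

lemma continuous_on_slope: "continuous_on dom slope"
proof (intro continuous_at_imp_continuous_on ballI)
  fix x assume "x \<in> dom"
  then obtain U where U: "open U" "x \<in> U" "\<And>y. y \<in> U \<Longrightarrow> slope y = slope x"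
    using locally_affine by metis
  show "isCont slope x"
  proof (subst isCont_cong)
    show "\<forall>\<^sub>F y in nhds x. slope y = slope x"
      using U unfolding eventually_nhds by blast
  qed simp
qed

lemma T_C1: "T C1_differentiable_on dom"
  unfolding C1_differentiable_on_def
  using T_has_derivative continuous_on_slope
  by (auto intro!: exI[of _ slope] simp: has_real_derivative_iff_has_vector_derivative)

lemma T_piece1: "x \<in> {0<..<\<theta>} \<Longrightarrow> T x = (x + 1 - \<theta>) / 2"
  and T_piece2: "x \<in> {\<theta><..<1/2} \<Longrightarrow> T x = (x - \<theta>) / 2"
  and T_piece3: "x \<in> {1/2<..<3/4} \<Longrightarrow> T x = 1 - \<theta> / 2 - x"
  and T_piece4: "x \<in> {3/4<..<1} \<Longrightarrow> T x = 2 * x - 1"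
  using theta_less_half by (auto simp: T_def)

lemma inj_T: "inj_on T dom"
  unfolding dom_eq using theta_pos theta_less_half
  by (intro inj_onI) (auto simp: T_piece1 T_piece2 T_piece3 T_piece4)

lemma T_dom_subset: "T ` dom \<subseteq> {0<..<1}"
  unfolding dom_eq using theta_pos theta_less_half
  by (auto simp: T_piece1 T_piece2 T_piece3 T_piece4)

text \<open>From left to right, the images of the second, third, first and fourth branch fill
  \<open>{0..1}\<close> up to endpoints. The witnesses are the inverse branches.\<close>

lemma image_T_cofinite: "{0..1} - T ` dom \<subseteq> {0, 1/4 - \<theta> / 2, 1/2 - \<theta> / 2, 1/2, 1}"
proof
  fix y assume y: "y \<in> {0..1} - T ` dom"
  show "y \<in> {0, 1/4 - \<theta> / 2, 1/2 - \<theta> / 2, 1/2, 1}"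
  proof (rule ccontr)
    assume "y \<notin> {0, 1/4 - \<theta> / 2, 1/2 - \<theta> / 2, 1/2, 1}"
    then consider "y \<in> {0<..<1/4 - \<theta> / 2}" | "y \<in> {1/4 - \<theta> / 2<..<1/2 - \<theta> / 2}"
      | "y \<in> {1/2 - \<theta> / 2<..<1/2}" | "y \<in> {1/2<..<1}"
      using y by fastforce
    then have "\<exists>x\<in>dom. T x = y"
    proof cases
      case 1
      then show ?thesis
        using theta_pos theta_less_half
        by (intro bexI[of _ "2 * y + \<theta>"]) (auto simp: T_piece2 dom_eq)
    next
      case 2
      then show ?thesis
        using theta_pos theta_less_half
        by (intro bexI[of _ "1 - \<theta> / 2 - y"]) (auto simp: T_piece3 dom_eq)
    next
      case 3
      then show ?thesis
        using theta_pos theta_less_half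
        by (intro bexI[of _ "2 * y + \<theta> - 1"]) (auto simp: T_piece1 dom_eq field_simps)
    next
      case 4
      then show ?thesis
        using theta_pos theta_less_half
        by (intro bexI[of _ "(y + 1) / 2"]) (auto simp: T_piece4 dom_eq field_simps)
    qed
    then show False
      using y by blast
  qed
qed

text \<open>The left and right limits are 1/2 and 0 at \<open>\<theta>\<close>,
  \<open>1/4 - \<theta> / 2\<close> and \<open>1/2 - \<theta> / 2\<close> at 1/2,
  \<open>1/4 - \<theta> / 2\<close> and 1/2 at 3/4.\<close>

lemma not_removable:
  assumes "x \<in> D - {0, 1}"
  shows "\<not> (\<exists>l. (T \<longlongrightarrow> l) (at x within dom))"
proof -
  from assms consider "x = \<theta>" | "x = 1/2" | "x = 3/4"
    by (auto simp: D_def)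
  then show ?thesis
  proof cases
    case 1
    then show ?thesis
      using theta_pos theta_less_half
      by (intro no_limit_if_one_sided_limits_differ[of 0 _ "1/2" _ _ "\<lambda>y. (y + 1 - \<theta>) / 2" "\<lambda>y. (y - \<theta>) / 2"])
         (auto simp: dom_eq T_piece1 T_piece2)
  next
    case 2
    then show ?thesis
      using theta_pos theta_less_half
      by (intro no_limit_if_one_sided_limits_differ[of \<theta> _ "3/4" _ _ "\<lambda>y. (y - \<theta>) / 2" "\<lambda>y. 1 - \<theta> / 2 - y"])
         (auto simp: dom_eq T_piece2 T_piece3)
  next
    case 3
    then show ?thesis
      using theta_pos theta_less_half
      by (intro no_limit_if_one_sided_limits_differ[of "1/2" _ 1 _ _ "\<lambda>y. 1 - \<theta> / 2 - y" "\<lambda>y. 2 * y - 1"])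
         (auto simp: dom_eq T_piece3 T_piece4)
  qed
qed

lemma AIET_T: "AIET 0 1 D T"
  unfolding AIET_def
proof
  have "card D = 5"
    unfolding D_def using theta_pos theta_less_half by (subst card_insert_disjoint; force)+
  moreover have "\<exists>U. openin (top_of_set dom) U \<and> x \<in> U \<and> (\<lambda>y. \<bar>deriv T y\<bar>) constant_on U"
    if x: "x \<in> dom" for x
  proof -
    obtain U where U: "open U" "x \<in> U" "U \<subseteq> dom" "\<And>y. y \<in> U \<Longrightarrow> slope y = slope x"
      using locally_affine[OF x] by metis
    moreover have "deriv T y = slope x" if "y \<in> U" for y
      using that U(3) U(4)[of y] deriv_T[of y] by auto
    ultimately have "(\<lambda>y. \<bar>deriv T y\<bar>) constant_on U"
      unfolding constant_on_def by metis
    then show ?thesis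
      using open_subset[OF U(3,1)] U(2) by blast
  qed
  moreover have "finite ({0..1} - T ` dom)"
    using image_T_cofinite by (rule finite_subset) simp
  moreover have "0 < \<bar>deriv T x\<bar>" if "x \<in> dom" for x
    using that by (simp add: deriv_T slope_def)
  moreover have "T ` dom \<subseteq> {0..1}"
    by (rule order_trans[OF T_dom_subset]) auto
  ultimately show "n_AIET 4 0 1 D T"
    unfolding n_AIET_def using inj_T T_C1 not_removable theta_pos theta_less_half
    by (auto simp: D_def)
qed

lemma has_flips_T: "has_flips 0 1 D T"
proof -
  have "5/8 \<in> dom"
    by (simp add: dom_eq)
  moreover have "deriv T (5/8) = - 1"
    using deriv_T[OF \<open>5/8 \<in> dom\<close>] by (simp add: slope_def)
  ultimately show ?thesis
    unfolding has_flips_def oriented_def by (intro notI) (auto dest!: bspec[of _ _ "5/8"])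
qed

section \<open>The gaps as iterates of a wandering interval\<close>

lemma gap_subset_dom: "gap n \<subseteq> dom"
  using gap_subset[of n] theta_pos by (auto simp: dom_eq)

text \<open>On one gap \<open>T\<close> is affine of slope 1/2 and sends left end to left end by
  \<open>phi_p_Suc\<close>; the lengths match by \<open>w_Suc\<close>.\<close>

lemma image_T_gap: "T ` gap n = gap (Suc n)"
proof -
  have T: "T x = \<phi> (p (Suc n)) + (x - \<phi> (p n)) / 2" if "x \<in> gap n" for x
    using gap_subset_side[of n] that
    by (auto simp: phi_p_Suc T_piece1 T_piece2 field_simps split: if_splits)
  show ?thesis
  proof
    show "T ` gap n \<subseteq> gap (Suc n)"
      by (auto simp: T) (auto simp: gap_def w_Suc)
    show "gap (Suc n) \<subseteq> T ` gap n"
    proof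
      fix y assume "y \<in> gap (Suc n)"
      then have x: "\<phi> (p n) + 2 * (y - \<phi> (p (Suc n))) \<in> gap n"
        by (auto simp: gap_def w_Suc)
      show "y \<in> T ` gap n"
        by (rule image_eqI[OF _ x], subst T[OF x]) (simp add: field_simps)
    qed
  qed
qed

lemma forward_image_gap: "forward_image 0 1 D T m (gap 0) = gap m"
proof -
  have "((\<lambda>S. T ` (S \<inter> dom)) ^^ m) (gap 0) = gap m"
  proof (induction m)
    case (Suc m)
    then show ?case
      using gap_subset_dom[of m] by (simp add: Int_absorb2 image_T_gap)
  qed simp
  then show ?thesis
    by (simp add: forward_image_def)
qed

text \<open>Closed gaps, as finitely many of them are to be cut out of a neighbourhood. The
  intermediate point \<open>s\<close> makes the inequality at the upper end strict.\<close>

lemma phi_notin_closed_gap: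
  assumes "t \<in> {0<..<1} - range p"
  shows "\<phi> t \<notin> {\<phi> (p n)..\<phi> (p n) + w n}"
proof (cases "p n < t")
  case True
  then obtain s where s: "p n < s" "s < t"
    using dense by blast
  then have "\<phi> (p n) + w n \<le> \<phi> s"
    by (intro phi_add_w_le) auto
  also have "\<phi> s < \<phi> t"
    using s assms p_pos[of n] by (intro phi_strict_mono) auto
  finally show ?thesis
    by simp
next
  case False
  then have "t < p n"
    using assms by force
  then have "\<phi> t < \<phi> (p n)"
    using assms p_less_1[of n] by (intro phi_strict_mono) auto
  then show ?thesis
    by simp
qed

lemma phi_in_omega_limit:
  assumes "t \<in> {0<..<1} - range p"
  shows "\<phi> t \<in> omega_limit 0 1 D T (gap 0)"
  unfolding omega_limit_def forward_image_gap
proof (intro INT_I)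
  fix k :: nat
  show "\<phi> t \<in> closure (\<Union>m\<in>{k..}. gap m)"
  proof (subst closure_iff_nhds_not_empty, intro allI impI)
    fix A U assume U: "U \<subseteq> A" "open U" "\<phi> t \<in> U"
    \<comment> \<open>Cutting out the first \<open>k\<close> closed gaps leaves a neighbourhood of
      \<open>\<phi> t\<close>, so any gap that meets it has index at least \<open>k\<close>.\<close>
    define V where "V = U - (\<Union>n<k. {\<phi> (p n)..\<phi> (p n) + w n})"
    have "open V"
      unfolding V_def using U by (intro open_Diff closed_UN) auto
    moreover have "\<phi> t \<in> V \<inter> {0..1/2}"
      using U phi_notin_closed_gap[OF assms] phi_bounds[of t] assms by (auto simp: V_def)
    ultimately obtain n where n: "V \<inter> gap n \<noteq> {}"
      using gaps_dense[of V] by blast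
    then obtain x where x: "x \<in> V" "x \<in> gap n"
      by (metis disjoint_iff)
    have "x \<in> {\<phi> (p n)..\<phi> (p n) + w n}"
      using x(2) by (simp add: gap_def)
    then have "k \<le> n"
      using x(1) unfolding V_def by (metis DiffD2 UN_I lessThan_iff not_le)
    moreover have "x \<in> A"
      using x(1) U(1) unfolding V_def by blast
    ultimately show "(\<Union>m\<in>{k..}. gap m) \<inter> A \<noteq> {}"
      using x(2) by (metis IntI UN_I atLeast_iff empty_iff)
  qed
qed

lemma wandering_gap: "wandering_interval 0 1 D T (gap 0)"
proof -
  \<comment> \<open>The limit set contains the images of all points off the countable orbit, and
    \<open>\<phi>\<close> is injective on these.\<close>
  have "infinite (omega_limit 0 1 D T (gap 0))"
  proof
    assume "finite (omega_limit 0 1 D T (gap 0))"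
    then have "finite (\<phi> ` ({0<..<1} - range p))"
      by (rule finite_subset[rotated]) (use phi_in_omega_limit in blast)
    moreover have "inj_on \<phi> ({0<..<1} - range p)"
      by (intro inj_onI) (metis DiffD1 greaterThanLessThan_iff less_imp_le linorder_neqE phi_strict_mono order_less_irrefl)
    ultimately have "finite ({0<..<1} - range p)"
      by (rule finite_imageD)
    then have "countable ({0<..<1::real} - range p \<union> range p)"
      by (intro countable_Un) (auto intro: countable_finite)
    then have "countable {0<..<1::real}"
      by (rule countable_subset[rotated]) auto
    then show False
      using uncountable_open_interval[of 0 "1::real"] by simp
  qed
  moreover have "\<exists>x\<in>gap m. \<exists>y\<in>gap m. x \<noteq> y" for m
    using w_pos[of m]
    by (intro bexI[of _ "\<phi> (p m) + w m / 2"] bexI[of _ "\<phi> (p m) + w m / 3"]) (auto simp: gap_def)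
  moreover have "is_interval (gap m)" for m
    by (simp add: gap_def)
  moreover have "gap 0 \<subseteq> {0..1}"
    using gap_subset[of 0] by force
  ultimately show ?thesis
    unfolding wandering_interval_def forward_image_gap using disjoint_gaps by blast
qed

end

section \<open>Invariant measures\<close>

lemma (in finite_measure) finite_atoms_ge:
  assumes "\<And>x. {x} \<in> sets M" "0 < c"
  shows "finite {x. c \<le> measure M {x}}"
proof (rule ccontr)
  assume inf: "infinite {x. c \<le> measure M {x}}"
  obtain n :: nat where n: "measure M (space M) < real n * c"
    using \<open>0 < c\<close> reals_Archimedean3 by blast
  obtain A where A: "A \<subseteq> {x. c \<le> measure M {x}}" "card A = n" "finite A"
    using infinite_arbitrarily_large[OF inf] by blast
  have "real n * c \<le> (\<Sum>x\<in>A. measure M {x})"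
    using A sum_bounded_below[of A c "\<lambda>x. measure M {x}"] by (auto simp: subset_iff)
  also have "\<dots> = measure M A"
    using A assms by (intro finite_measure_eq_sum_singleton[symmetric]) auto
  also have "\<dots> \<le> measure M (space M)"
    by (rule bounded_measure)
  finally show False
    using n by simp
qed

lemma emeasure_lborel_translate:
  fixes A :: "real set"
  assumes "A \<in> sets borel"
  shows "emeasure lborel {t. c + t \<in> A} = emeasure lborel A"
proof -
  have "emeasure lborel A = emeasure (distr lborel borel ((+) c)) A"
    by (simp add: lborel_distr_plus)
  also have "\<dots> = emeasure lborel {t. c + t \<in> A}"
    using assms by (subst emeasure_distr) (auto simp: vimage_def)
  finally show ?thesis
    by simp
qed

context irrational_rotation
begin

lemma borel_measurable_T [measurable]: "T \<in> borel_measurable borel"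
  unfolding T_def[abs_def] by measurable

lemma borel_dom [measurable]: "dom \<in> sets borel"
  by (rule borel_open) (rule open_dom)

lemma borel_measurable_phi [measurable]: "\<phi> \<in> borel_measurable borel"
  by (intro borel_measurable_mono monoI phi_mono)

text \<open>The two scaling identities make \<open>\<phi>\<close> a semiconjugacy from the rotation
  to \<open>T\<close>, away from the break.\<close>

lemma T_phi:
  assumes "t \<in> {0<..<1}" "t \<noteq> 1 - \<alpha>"
  shows "\<phi> t \<in> dom" "T (\<phi> t) = (if t < 1 - \<alpha> then \<phi> (t + \<alpha>) else \<phi> (t + \<alpha> - 1))"
proof -
  have b: "0 < \<phi> t" "\<phi> t < 1/2"
    using phi_bounds[OF assms(1)] by auto
  have side: "if t < 1 - \<alpha> then \<phi> t < \<theta> else \<theta> < \<phi> t"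
    using assms phi_strict_mono[of t "1 - \<alpha>"] phi_strict_mono[of "1 - \<alpha>" t] alpha_pos alpha_less_1
    unfolding \<theta>_def by auto
  show "\<phi> t \<in> dom"
    using b side by (auto simp: dom_eq split: if_splits)
  show "T (\<phi> t) = (if t < 1 - \<alpha> then \<phi> (t + \<alpha>) else \<phi> (t + \<alpha> - 1))"
    using b side assms phi_add_alpha[of t] phi_add_alpha_minus_1[of t]
    by (auto simp: T_piece1 T_piece2 split: if_splits)
qed

end

text \<open>Measures live on the whole line here, so that distribution functions are available;
  measures on \<open>{0..1}\<close> are carried over at the end.\<close>

locale invariant_distribution = irrational_rotation \<alpha> + real_distribution M
  for \<alpha> :: real and M :: "real measure" +
  assumes invariant: "B \<in> sets borel \<Longrightarrow> prob {x \<in> dom. T x \<in> B} = prob B"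
begin

text \<open>Points of \<open>D\<close> have no image, so the preimage of the whole line is only
  \<open>dom\<close>.\<close>

lemma prob_dom: "prob dom = 1"
  using invariant[of UNIV] prob_space by simp

lemma prob_outside_dom:
  assumes "A \<in> sets borel" "A \<inter> dom = {}"
  shows "prob A = 0"
proof -
  have "prob A \<le> prob (space M - dom)"
    using assms by (intro finite_measure_mono) auto
  also have "\<dots> = 0"
    using prob_compl[of dom] prob_dom by simp
  finally show ?thesis
    using measure_nonneg[of M A] by linarith
qed

text \<open>By injectivity \<open>S\<close> is the full preimage of its image.\<close>

lemma prob_image:
  assumes "S \<subseteq> dom" "T ` S \<in> sets borel"
  shows "prob (T ` S) = prob S"
proof -
  have "{x \<in> dom. T x \<in> T ` S} = S"
    using assms inj_T by (auto dest: inj_onD)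
  then show ?thesis
    using invariant[OF assms(2)] by simp
qed

text \<open>The gaps are disjoint and have equal mass, which is therefore the limit of the terms of
  a convergent series.\<close>

lemma prob_gap: "prob (gap n) = 0"
proof -
  have const: "prob (gap n) = prob (gap 0)" for n
  proof (induction n)
    case (Suc n)
    then show ?case
      using prob_image[OF gap_subset_dom[of n]] open_gap[of "Suc n"] by (simp add: image_T_gap)
  qed simp
  have "(\<lambda>n. prob (gap n)) sums prob (\<Union>n. gap n)"
    using disjoint_gaps open_gap by (intro finite_measure_UNION) auto
  then have "(\<lambda>n. prob (gap n)) \<longlonglongrightarrow> 0"
    using sums_summable summable_LIMSEQ_zero by blast
  moreover have "(\<lambda>n. prob (gap n)) = (\<lambda>_. prob (gap 0))"
    using const by (rule ext)
  ultimately have "prob (gap 0) = 0"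
    by (simp only: LIMSEQ_const_iff)
  then show ?thesis
    using const[of n] by simp
qed

text \<open>Both branches on the left half increase, and the image of the right one lies below that
  of the left one; hence \<open>cdf M\<close> turns \<open>T\<close> into the rotation by
  \<open>1 - cdf M \<theta>\<close>. Concentration on the left half is assumed because the case of
  \<open>\<mu>\<close> serves to exclude atoms, before it is known in general.\<close>

lemma cdf_T:
  assumes half: "prob {0<..<1/2} = 1" and x: "x \<in> {0<..<1/2} - {\<theta>}"
  shows "cdf M (T x) = cdf M x + (1 - cdf M \<theta>) - of_bool (\<theta> < x)"
proof -
  have Int_half: "prob (A \<inter> {0<..<1/2}) = prob A" if "A \<in> sets borel" for A
  proof -
    have "AE y in M. y \<in> {0<..<1/2}"
      using half by (subst prob_eq_1[symmetric]) auto
    then show ?thesis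
      using that by (intro finite_measure_eq_AE) auto
  qed
  have upper: "prob {\<theta><..} = 1 - cdf M \<theta>"
    using prob_compl[of "{..\<theta>}"] by (simp add: cdf_def Compl_eq_Diff_UNIV[symmetric])
  define A where "A = {y \<in> dom. T y \<in> {..T x}}"
  have A: "A \<in> sets borel"
    unfolding A_def by measurable
  have "cdf M (T x) = prob A"
    using invariant[of "{..T x}"] by (simp add: cdf_def A_def)
  also have "\<dots> = prob (A \<inter> {0<..<1/2})"
    using Int_half[OF A] by simp
  also have "\<dots> = cdf M x + (1 - cdf M \<theta>) - of_bool (\<theta> < x)"
  proof (cases "x < \<theta>")
    case True
    then have "A \<inter> {0<..<1/2} = ({..x} \<union> {\<theta><..}) \<inter> {0<..<1/2}"
      using x theta_less_half by (auto simp: A_def dom_eq T_piece1 T_piece2)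
    then have "prob (A \<inter> {0<..<1/2}) = prob ({..x} \<union> {\<theta><..})"
      using Int_half[of "{..x} \<union> {\<theta><..}"] by simp
    also have "\<dots> = prob {..x} + prob {\<theta><..}"
      using True by (intro finite_measure_Union) auto
    also have "\<dots> = cdf M x + (1 - cdf M \<theta>)"
      unfolding upper by (simp add: cdf_def)
    finally show ?thesis
      using True by simp
  next
    case False
    then have "A \<inter> {0<..<1/2} = {\<theta><..x} \<inter> {0<..<1/2}"
      using x theta_pos by (auto simp: A_def dom_eq T_piece1 T_piece2)
    then have "prob (A \<inter> {0<..<1/2}) = cdf M x - cdf M \<theta>"
      using Int_half[of "{\<theta><..x}"] cdf_diff_eq[of \<theta> x] False x by simp
    then show ?thesis
      using False x by simp
  qed
  finally show ?thesis .
qed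

end

section \<open>The image of Lebesgue measure, and finite invariant sets\<close>

context irrational_rotation
begin

definition \<mu> :: "real measure" where
  "\<mu> = distr (uniform_measure lborel {0<..<1}) borel \<phi>"

lemma prob_space_mu: "prob_space \<mu>"
  unfolding \<mu>_def by (intro prob_space.prob_space_distr prob_space_uniform_measure) auto

lemma emeasure_mu: "B \<in> sets borel \<Longrightarrow> emeasure \<mu> B = emeasure lborel {t \<in> {0<..<1}. \<phi> t \<in> B}"
  unfolding \<mu>_def
  by (subst emeasure_distr) (auto simp: divide_ennreal_def vimage_def Int_def)

text \<open>Pulled back by \<open>\<phi>\<close>, this is the invariance of Lebesgue measure under
  the rotation: \<open>U\<close> is the preimage of \<open>V\<close> up to null sets.\<close>

lemma emeasure_mu_vimage_T:
  assumes [measurable]: "B \<in> sets borel"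
  shows "emeasure \<mu> {x \<in> dom. T x \<in> B} = emeasure \<mu> B"
proof -
  define V where "V = {t \<in> {0<..<1}. \<phi> t \<in> B}"
  define U where "U = {t \<in> {0<..<1}. \<phi> t \<in> dom \<and> T (\<phi> t) \<in> B}"
  have [measurable]: "V \<in> sets borel" "U \<in> sets borel"
    unfolding V_def U_def by measurable
  \<comment> \<open>The points moved by \<open>\<alpha>\<close> land above \<open>\<alpha>\<close>,
    those moved by \<open>\<alpha> - 1\<close> land below it.\<close>
  have U: "U - {1 - \<alpha>} = {t. \<alpha> + t \<in> V \<inter> {\<alpha><..<1}} \<union> {t. (\<alpha> - 1) + t \<in> V \<inter> {0<..<\<alpha>}}"
    using alpha_pos alpha_less_1 by (auto simp: U_def V_def T_phi algebra_simps split: if_splits)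
  have "emeasure lborel U = emeasure lborel (U - {1 - \<alpha>})"
    by (rule emeasure_Diff_null_set[symmetric]) (auto simp: null_sets_def)
  also have "\<dots> = emeasure lborel {t. \<alpha> + t \<in> V \<inter> {\<alpha><..<1}} +
      emeasure lborel {t. (\<alpha> - 1) + t \<in> V \<inter> {0<..<\<alpha>}}"
    unfolding U by (subst plus_emeasure) auto
  also have "\<dots> = emeasure lborel (V \<inter> {\<alpha><..<1}) + emeasure lborel (V \<inter> {0<..<\<alpha>})"
    by (simp only: emeasure_lborel_translate sets.Int \<open>V \<in> sets borel\<close> borel_open open_greaterThanLessThan)
  also have "\<dots> = emeasure lborel (V \<inter> {\<alpha><..<1} \<union> V \<inter> {0<..<\<alpha>})"
    by (subst plus_emeasure) auto
  also have "V \<inter> {\<alpha><..<1} \<union> V \<inter> {0<..<\<alpha>} = V - {\<alpha>}"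
    using alpha_pos alpha_less_1 by (auto simp: V_def)
  also have "emeasure lborel (V - {\<alpha>}) = emeasure lborel V"
    by (rule emeasure_Diff_null_set) (auto simp: null_sets_def)
  finally show ?thesis
    by (simp add: emeasure_mu U_def V_def)
qed

lemma invariant_distribution_mu: "invariant_distribution \<alpha> \<mu>"
proof -
  interpret prob_space \<mu>
    by (rule prob_space_mu)
  show ?thesis
    by unfold_locales (simp_all add: \<mu>_def[THEN arg_cong[of _ _ sets]] \<mu>_def[THEN arg_cong[of _ _ space]]
      measure_def emeasure_mu_vimage_T)
qed

sublocale mu: invariant_distribution \<alpha> \<mu>
  by (rule invariant_distribution_mu)

lemma mu_half: "mu.prob {0<..<1/2} = 1"
proof -
  have "{t \<in> {0<..<1}. \<phi> t \<in> {0<..<1/2}} = {0<..<1}"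
    using phi_bounds by auto
  then show ?thesis
    using emeasure_mu[of "{0<..<1/2}"] by (simp add: measure_def)
qed

text \<open>\<open>\<phi> t \<le> \<theta>\<close> amounts to \<open>t \<le> 1 - \<alpha>\<close>;
  in \<open>cdf_T\<close> this gives the rotation by \<open>\<alpha>\<close> itself.\<close>

lemma cdf_mu_theta: "cdf \<mu> \<theta> = 1 - \<alpha>"
proof -
  have "{t \<in> {0<..<1}. \<phi> t \<in> {..\<theta>}} = {0<..1 - \<alpha>}"
    unfolding \<theta>_def using alpha_pos alpha_less_1 phi_less_iff[of "1 - \<alpha>"] by (auto simp: not_less[symmetric])
  then show ?thesis
    using emeasure_mu[of "{..\<theta>}"] alpha_less_1 by (simp add: cdf_def measure_def)
qed

lemma cdf_mu_T:
  "x \<in> {0<..<1/2} - {\<theta>} \<Longrightarrow> cdf \<mu> (T x) = cdf \<mu> x + \<alpha> - of_bool (\<theta> < x)"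
  using mu.cdf_T[OF mu_half] by (simp add: cdf_mu_theta)

text \<open>To the right of \<open>1/2\<close> a maximal point cannot have a preimage.  To the left, summing
  \<open>cdf_mu_T\<close> over the set makes a nonzero multiple of \<open>\<alpha>\<close> an integer.\<close>

lemma no_finite_invariant_set:
  assumes "finite S" "S \<subseteq> dom" "T ` S = S"
  shows "S = {}"
proof (rule ccontr)
  assume "S \<noteq> {}"
  have less_half: "x < 1/2" if "x \<in> S" for x
  proof (rule ccontr)
    assume "\<not> x < 1/2"
    have max: "Max S \<in> S" "x \<le> Max S" "\<And>y. y \<in> S \<Longrightarrow> y \<le> Max S"
      using \<open>finite S\<close> \<open>S \<noteq> {}\<close> that by auto
    then obtain y where y: "y \<in> S" "Max S = T y"
      using \<open>T ` S = S\<close> by (metis imageE)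
    have "y \<in> dom" "T y \<in> dom"
      using y max assms(2) by auto
    moreover have "1/2 \<le> T y"
      using max(2) \<open>\<not> x < 1/2\<close> y(2) by simp
    \<comment> \<open>Only the fourth branch reaches points above 1/2, and there
      \<open>2 * y - 1 < y\<close>.\<close>
    ultimately have "T y < y"
      using theta_pos theta_less_half by (auto simp: dom_eq T_piece1 T_piece2 T_piece3 T_piece4)
    then show False
      using max(3)[OF y(1)] y(2) by simp
  qed
  have S: "S \<subseteq> {0<..<1/2} - {\<theta>}"
  proof
    fix x assume "x \<in> S"
    then show "x \<in> {0<..<1/2} - {\<theta>}"
      using assms(2) less_half[of x] theta_pos by (auto simp: dom_eq)
  qed
  have "(\<Sum>x\<in>S. cdf \<mu> x) = (\<Sum>x\<in>T ` S. cdf \<mu> x)"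
    by (simp add: assms(3))
  also have "\<dots> = (\<Sum>x\<in>S. cdf \<mu> (T x))"
    by (subst sum.reindex) (auto intro: inj_on_subset[OF inj_T assms(2)])
  also have "\<dots> = (\<Sum>x\<in>S. cdf \<mu> x + \<alpha> - of_bool (\<theta> < x))"
    using S by (intro sum.cong refl cdf_mu_T) auto
  also have "\<dots> = (\<Sum>x\<in>S. cdf \<mu> x) + real (card S) * \<alpha> - real_of_int (\<Sum>x\<in>S. of_bool (\<theta> < x))"
    by (simp add: sum.distrib sum_subtractf)
  finally have "of_int (int (card S)) * \<alpha> = of_int (\<Sum>x\<in>S. of_bool (\<theta> < x))"
    by simp
  from mult_alpha_eq_of_int[OF this] show False
    using \<open>finite S\<close> \<open>S \<noteq> {}\<close> by simp
qed

end

section \<open>Null sets and the distribution function of an invariant distribution\<close>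

context invariant_distribution
begin

text \<open>Singletons in \<open>dom\<close> keep their mass under \<open>T\<close>, so the heaviest
  atoms are permuted; \<open>no_finite_invariant_set\<close> rules this out.\<close>

lemma prob_singleton: "prob {x} = 0"
proof (rule ccontr)
  assume x: "prob {x} \<noteq> 0"
  \<comment> \<open>Only finitely many atoms weigh at least as much as \<open>{x}\<close>, so a
    heaviest atom \<open>z\<close> exists.\<close>
  define A where "A = {y. prob {x} \<le> prob {y}}"
  have "finite A"
    unfolding A_def using x by (intro finite_atoms_ge) (auto simp: less_le)
  moreover have "x \<in> A"
    by (simp add: A_def)
  ultimately obtain z where "z \<in> A" "prob {z} = Max ((\<lambda>y. prob {y}) ` A)"
    using Max_in[of "(\<lambda>y. prob {y}) ` A"] by fastforce
  then have z: "z \<in> A" "\<And>y. y \<in> A \<Longrightarrow> prob {y} \<le> prob {z}"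
    using \<open>finite A\<close> by auto
  define S where "S = {y. prob {y} = prob {z}}"
  have "S \<subseteq> A"
    using z by (auto simp: S_def A_def)
  then have "finite S"
    using \<open>finite A\<close> by (rule finite_subset)
  have "prob {z} \<noteq> 0"
    using z(2)[OF \<open>x \<in> A\<close>] x measure_nonneg[of M "{x}"] by linarith
  then have dom: "S \<subseteq> dom"
    using prob_outside_dom[of "{y}" for y] by (fastforce simp: S_def)
  have "T ` S \<subseteq> S"
    using dom prob_image[of "{y}" for y] by (auto simp: S_def)
  then have "T ` S = S"
    using \<open>finite S\<close> inj_on_subset[OF inj_T dom] by (intro endo_inj_surj)
  then have "S = {}"
    by (rule no_finite_invariant_set[OF \<open>finite S\<close> dom])
  then show False
    by (auto simp: S_def)
qed

text \<open>The fourth branch maps each \<open>B (Suc n)\<close> onto \<open>B n\<close>, so all of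
  them have the mass of \<open>B 0\<close>, the right half; yet they shrink to the empty
  set.\<close>

lemma prob_right_half: "prob {1/2<..<1} = 0"
proof -
  define B :: "nat \<Rightarrow> real set" where "B n = {1 - (1/2) ^ Suc n<..<1}" for n
  have image: "T ` B (Suc n) = B n" for n
  proof
    have le: "(1/2) ^ n \<le> (1::real)"
      by (rule power_le_one) auto
    have T: "T x = 2 * x - 1" if "x \<in> B (Suc n)" for x
      using that le by (intro T_piece4) (auto simp: B_def)
    show "T ` B (Suc n) \<subseteq> B n"
      by (auto simp: T) (auto simp: B_def)
    show "B n \<subseteq> T ` B (Suc n)"
    proof
      fix y assume "y \<in> B n"
      then have x: "(y + 1) / 2 \<in> B (Suc n)"
        by (auto simp: B_def field_simps)
      show "y \<in> T ` B (Suc n)"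
        by (rule image_eqI[OF _ x], subst T[OF x]) (simp add: field_simps)
    qed
  qed
  have dom: "B (Suc n) \<subseteq> dom" for n
  proof -
    have "(1/2) ^ n \<le> (1::real)"
      by (rule power_le_one) auto
    then show ?thesis
      by (auto simp: B_def dom_eq)
  qed
  have const: "prob (B n) = prob (B 0)" for n
  proof (induction n)
    case (Suc n)
    then show ?case
      using prob_image[OF dom[of n]] by (simp add: image) (simp add: B_def)
  qed simp
  have "(\<lambda>n. prob (B n)) \<longlonglongrightarrow> prob (\<Inter>n. B n)"
  proof (rule finite_Lim_measure_decseq)
    show "decseq B"
      by (rule decseq_SucI) (auto simp: B_def)
  qed (auto simp: B_def)
  also have "(\<Inter>n. B n) = {}"
  proof -
    have "\<exists>n. x \<notin> B n" for x
    proof (cases "x < 1")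
      case True
      then obtain n where "(1/2) ^ n < 1 - x"
        using real_arch_pow_inv[of "1 - x" "1/2"] by auto
      moreover have "(1/2) ^ Suc n \<le> (1/2::real) ^ n"
        by simp
      ultimately have "x \<notin> B n"
        unfolding B_def greaterThanLessThan_iff by linarith
      then show ?thesis ..
    qed (simp add: B_def)
    then show ?thesis
      by auto
  qed
  finally have "(\<lambda>n. prob (B n)) \<longlonglongrightarrow> 0"
    by simp
  moreover have "(\<lambda>n. prob (B n)) = (\<lambda>_. prob (B 0))"
    using const by (rule ext)
  ultimately have "prob (B 0) = 0"
    by (simp only: LIMSEQ_const_iff)
  then show ?thesis
    by (simp add: B_def)
qed

lemma prob_left_half: "prob {0<..<1/2} = 1"
proof -
  have "prob dom \<le> prob ({0<..<1/2} \<union> ({1/2} \<union> {1/2<..<1}))"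
    using theta_pos theta_less_half
    by (intro finite_measure_mono) (auto simp: dom_eq)
  also have "\<dots> \<le> prob {0<..<1/2} + (prob {1/2} + prob {1/2<..<1})"
    using measure_Un_le[of "{0<..<1/2}" M "{1/2} \<union> {1/2<..<1}"]
      measure_Un_le[of "{1/2}" M "{1/2<..<1}"] by simp
  finally show ?thesis
    using prob_dom prob_singleton[of "1/2"] prob_right_half prob_le_1[of "{0<..<1/2}"] by simp
qed

text \<open>Iterate \<open>cdf_T\<close> along the left ends of the gaps: each step adds
  \<open>1 - cdf M \<theta>\<close> and subtracts 1 to the right of \<open>\<theta>\<close>.\<close>

lemma cdf_gap_orbit:
  "cdf M (\<phi> (p n)) = real (Suc n) * (1 - cdf M \<theta>) - (\<Sum>k<n. of_bool (\<theta> < \<phi> (p k)))"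
proof (induction n)
  case 0
  \<comment> \<open>\<open>\<phi> \<alpha>\<close> is the supremum of the image of the second
    branch, so this preimage is the domain of that branch.\<close>
  define A where "A = {x \<in> dom. T x \<in> {..\<phi> \<alpha>}}"
  have "cdf M (\<phi> \<alpha>) = prob A"
    using invariant[of "{..\<phi> \<alpha>}"] by (simp add: cdf_def A_def)
  also have "A = {\<theta><..<1/2}"
    using theta_pos theta_less_half
    by (auto simp: A_def phi_alpha dom_eq T_piece1 T_piece2 T_piece3 T_piece4)
  also have "prob \<dots> = prob {\<theta><..}"
  proof -
    have "AE y in M. y \<in> {0<..<1/2}"
      using prob_left_half by (subst prob_eq_1[symmetric]) auto
    then show ?thesis
      using theta_pos by (intro finite_measure_eq_AE) auto
  qed
  also have "\<dots> = 1 - cdf M \<theta>"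
    using prob_compl[of "{..\<theta>}"] by (simp add: cdf_def Compl_eq_Diff_UNIV[symmetric])
  finally show ?case
    by (simp add: p_0)
next
  case (Suc n)
  have side: "\<phi> (p n) \<in> (if p n < 1 - \<alpha> then {0<..<\<theta>} else {\<theta><..<1/2})"
    unfolding \<theta>_def
    using phi_bounds[of "p n"] p_pos[of n] p_less_1[of n] p_neq_one_minus_alpha[of n] alpha_pos alpha_less_1
      phi_less_iff[of "p n" "1 - \<alpha>"] phi_less_iff[of "1 - \<alpha>" "p n"] by auto
  then have "\<phi> (p (Suc n)) = T (\<phi> (p n))"
    by (auto simp: phi_p_Suc T_piece1 T_piece2 split: if_splits)
  moreover have "\<phi> (p n) \<in> {0<..<1/2} - {\<theta>}"
    using side theta_pos theta_less_half by (auto split: if_splits)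
  ultimately show ?case
    using cdf_T[OF prob_left_half, of "\<phi> (p n)"] Suc.IH by (simp add: algebra_simps)
qed

lemma cdf_on_gap:
  assumes "x \<in> gap n"
  shows "cdf M x = cdf M (\<phi> (p n))"
proof -
  have "cdf M x - cdf M (\<phi> (p n)) = prob {\<phi> (p n)<..x}"
    using assms by (intro cdf_diff_eq) (simp add: gap_def)
  also have "\<dots> \<le> prob (gap n)"
    using assms open_gap[of n] by (intro finite_measure_mono) (auto simp: gap_def)
  also have "\<dots> = 0"
    by (rule prob_gap)
  finally show ?thesis
    using cdf_nondecreasing[of "\<phi> (p n)" x] assms by (simp add: gap_def)
qed

lemma cdf_outside:
  shows "x < 0 \<Longrightarrow> cdf M x = 0" "1/2 \<le> x \<Longrightarrow> cdf M x = 1"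
proof -
  show "cdf M x = 0" if "x < 0"
    unfolding cdf_def using that theta_pos by (intro prob_outside_dom) (auto simp: dom_eq)
  show "cdf M x = 1" if "1/2 \<le> x"
  proof -
    have "prob {0<..<1/2} \<le> cdf M x"
      unfolding cdf_def using that by (intro finite_measure_mono) auto
    then show ?thesis
      using prob_left_half prob_le_1[of "{..x}"] by (simp add: cdf_def)
  qed
qed

end

section \<open>Uniqueness of the invariant distribution\<close>

context irrational_rotation
begin

text \<open>By \<open>cdf_gap_orbit\<close> the rotation number \<open>1 - cdf M \<theta>\<close> is determined up to \<open>1 / Suc n\<close> by the
  itinerary of the gaps, which does not depend on the measure.\<close>

lemma cdf_theta_unique:
  assumes "invariant_distribution \<alpha> M" "invariant_distribution \<alpha> N"
  shows "cdf M \<theta> = cdf N \<theta>"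
proof (rule ccontr)
  interpret M: invariant_distribution \<alpha> M by fact
  interpret N: invariant_distribution \<alpha> N by fact
  assume "cdf M \<theta> \<noteq> cdf N \<theta>"
  then obtain n where n: "1 < real n * \<bar>cdf M \<theta> - cdf N \<theta>\<bar>"
    using reals_Archimedean3[of "\<bar>cdf M \<theta> - cdf N \<theta>\<bar>"] by auto
  \<comment> \<open>The itinerary sums are the same for both measures and cancel.\<close>
  have "real (Suc n) * (cdf M \<theta> - cdf N \<theta>) = cdf N (\<phi> (p n)) - cdf M (\<phi> (p n))"
    unfolding M.cdf_gap_orbit N.cdf_gap_orbit by (simp add: algebra_simps)
  then have "real (Suc n) * \<bar>cdf M \<theta> - cdf N \<theta>\<bar> = \<bar>cdf N (\<phi> (p n)) - cdf M (\<phi> (p n))\<bar>"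
    by (metis abs_mult abs_of_nat)
  also have "\<dots> \<le> 1"
    using M.prob_le_1[of "{..\<phi> (p n)}"] N.prob_le_1[of "{..\<phi> (p n)}"]
      measure_nonneg[of M "{..\<phi> (p n)}"] measure_nonneg[of N "{..\<phi> (p n)}"]
    unfolding cdf_def by linarith
  finally have "real (Suc n) * \<bar>cdf M \<theta> - cdf N \<theta>\<bar> \<le> 1" .
  moreover have "real n * \<bar>cdf M \<theta> - cdf N \<theta>\<bar> \<le> real (Suc n) * \<bar>cdf M \<theta> - cdf N \<theta>\<bar>"
    by (intro mult_right_mono) auto
  ultimately show False
    using n by linarith
qed

text \<open>The two functions agree on the dense gaps; right continuity of \<open>cdf M\<close> and
  monotonicity of \<open>cdf N\<close> extend this to an inequality everywhere, and exchanging the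
  roles gives equality.\<close>

lemma cdf_le_cdf:
  assumes M: "invariant_distribution \<alpha> M" and N: "invariant_distribution \<alpha> N"
  shows "cdf N x \<le> cdf M x"
proof -
  interpret M: invariant_distribution \<alpha> M by fact
  interpret N: invariant_distribution \<alpha> N by fact
  consider "x < 0" | "1/2 \<le> x" | "0 \<le> x" "x < 1/2"
    by linarith
  then show ?thesis
  proof cases
    case 3
    show ?thesis
    proof (rule ccontr)
      assume "\<not> cdf N x \<le> cdf M x"
      then have "cdf M x < cdf N x"
        by simp
      moreover have "(cdf M \<longlongrightarrow> cdf M x) (at_right x)"
        using M.cdf_is_right_cont[of x] by (simp add: continuous_within)
      ultimately have "\<forall>\<^sub>F y in at_right x. cdf M y < cdf N x"
        by (rule order_tendstoD(2)[rotated])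
      then obtain b where b: "x < b" "\<And>y. x < y \<Longrightarrow> y < b \<Longrightarrow> cdf M y < cdf N x"
        using eventually_at_right[of x "1 + x"] by auto
      \<comment> \<open>\<open>b\<close> may exceed 1/2; the minimum keeps the witness in the region
        where the gaps are dense.\<close>
      have "(x + min b (1/2)) / 2 \<in> {x<..<b} \<inter> {0..1/2}"
        using b 3 by (auto simp: min_def)
      then obtain n where "{x<..<b} \<inter> gap n \<noteq> {}"
        using gaps_dense[of "{x<..<b}"] by (metis empty_iff open_greaterThanLessThan)
      then obtain y where y: "x < y" "y < b" "y \<in> gap n"
        by auto
      have "cdf M y = cdf N y"
        unfolding M.cdf_on_gap[OF y(3)] N.cdf_on_gap[OF y(3)] M.cdf_gap_orbit N.cdf_gap_orbit
        using cdf_theta_unique[OF M N] by simp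
      moreover have "cdf N x \<le> cdf N y"
        using y by (intro N.cdf_nondecreasing) simp
      ultimately show False
        using b(2)[OF y(1,2)] by simp
    qed
  qed (simp_all add: M.cdf_outside N.cdf_outside)
qed

lemma invariant_distribution_unique:
  assumes "invariant_distribution \<alpha> M"
  shows "M = \<mu>"
proof -
  interpret M: invariant_distribution \<alpha> M by fact
  have "cdf M x = cdf \<mu> x" for x
    using cdf_le_cdf[OF assms invariant_distribution_mu] cdf_le_cdf[OF invariant_distribution_mu assms]
    by (rule order_antisym[rotated])
  then show ?thesis
    using cdf_unique[OF M.real_distribution_axioms mu.real_distribution_axioms] by blast
qed

end

section \<open>The support of the invariant measure\<close>

text \<open>Each point of \<open>V \<inter> S\<close> has a null open neighbourhood; by the Lindelof
  property countably many of these suffice.\<close>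

lemma emeasure_disjoint_support_eq_0:
  assumes M: "sets M = sets (restrict_space borel S)" and "open V" "V \<inter> measure_support M = {}"
  shows "emeasure M (V \<inter> S) = 0"
proof -
  have space: "space M = S"
    using sets_eq_imp_space_eq[OF M] by (simp add: space_restrict_space)
  define \<U> where "\<U> = {U. open U \<and> emeasure M (U \<inter> S) = 0}"
  obtain \<V> where \<V>: "\<V> \<subseteq> \<U>" "countable \<V>" "\<Union>\<V> = \<Union>\<U>"
    using Lindelof[of \<U>] unfolding \<U>_def by blast
  have sets: "U \<inter> S \<in> sets M" if "open U" for U
    unfolding M sets_restrict_space using that by (auto simp: Int_commute)
  have "V \<inter> S \<subseteq> (\<Union>U\<in>\<V>. U \<inter> S)"
  proof
    fix x assume x: "x \<in> V \<inter> S"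
    then have "x \<notin> measure_support M"
      using assms(3) by blast
    then obtain U where "open U" "x \<in> U" "emeasure M (U \<inter> S) = 0"
      using x unfolding measure_support_def space by (auto simp: zero_less_iff_neq_zero)
    then have "x \<in> \<Union>\<V>"
      unfolding \<V>(3) by (auto simp: \<U>_def)
    then show "x \<in> (\<Union>U\<in>\<V>. U \<inter> S)"
      using x by blast
  qed
  moreover have "(\<Union>U\<in>\<V>. U \<inter> S) \<in> null_sets M"
    using \<V> sets by (intro null_sets_UN') (auto simp: null_sets_def \<U>_def)
  ultimately show ?thesis
    using null_sets_subset[OF _ sets[OF \<open>open V\<close>]] by blast
qed

lemma closed_measure_support:
  assumes "space M = S" "closed S"
  shows "closed (measure_support M)"
proof -
  have "measure_support M = S - \<Union>{U. open U \<and> emeasure M (U \<inter> S) = 0}"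
    by (auto simp: measure_support_def assms zero_less_iff_neq_zero)
  then show ?thesis
    using assms by (auto intro!: closed_Diff open_Union)
qed

text \<open>An isolated point of the support would have a null neighbourhood, since it is no atom
  itself; a connected subset with two points would contain an interval, which meets a null open
  set.\<close>

lemma cantor_set_measure_support:
  assumes M: "sets M = sets (restrict_space borel S)" and "compact S"
    and "emeasure M S \<noteq> 0"
    and atomless: "\<And>x. x \<in> S \<Longrightarrow> emeasure M {x} = 0"
    and null: "\<And>x y. x < y \<Longrightarrow> {x..y} \<subseteq> S \<Longrightarrow> \<exists>U. open U \<and> U \<inter> {x..y} \<noteq> {} \<and> emeasure M (U \<inter> S) = 0"
  shows "cantor_set (measure_support M)"
proof -
  have space: "space M = S"
    using sets_eq_imp_space_eq[OF M] by (simp add: space_restrict_space)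
  have sub: "measure_support M \<subseteq> S"
    by (auto simp: measure_support_def space)
  have sets: "B \<inter> S \<in> sets M" if "B \<in> sets borel" for B
    unfolding M sets_restrict_space using that by (auto simp: Int_commute)
  have closed: "closed (measure_support M)"
    using closed_measure_support[OF space] \<open>compact S\<close> by (simp add: compact_imp_closed)
  have "measure_support M \<noteq> {}"
    using emeasure_disjoint_support_eq_0[OF M, of UNIV] assms(3) by auto
  moreover have "compact (measure_support M)"
    using compact_Int_closed[OF \<open>compact S\<close> closed] sub by (simp add: Int_absorb1)
  moreover have "x islimpt measure_support M" if x: "x \<in> measure_support M" for x
    unfolding islimpt_def
  proof (intro allI impI, rule ccontr)
    fix U assume U: "x \<in> U" "open U" and "\<not> (\<exists>y\<in>measure_support M. y \<in> U \<and> y \<noteq> x)"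
    then have "(U - {x}) \<inter> measure_support M = {}"
      by blast
    then have "emeasure M ((U - {x}) \<inter> S) = 0"
      using U by (intro emeasure_disjoint_support_eq_0[OF M]) auto
    moreover have "x \<in> S"
      using x sub by blast
    then have "U \<inter> S = ((U - {x}) \<inter> S) \<union> {x}"
      using U by blast
    moreover have "(U - {x}) \<inter> S \<in> sets M" "{x} \<in> sets M"
      using sets[of "U - {x}"] sets[of "{x}"] U \<open>x \<in> S\<close> by auto
    ultimately have "emeasure M (U \<inter> S) = 0"
      using emeasure_subadditive[of "(U - {x}) \<inter> S" M "{x}"] atomless[OF \<open>x \<in> S\<close>] by simp
    moreover have "0 < emeasure M (U \<inter> S)"
      using x U by (simp add: measure_support_def space)
    ultimately show False
      by simp
  qed
  moreover have "x \<in> measure_support M" if "x islimpt measure_support M" for x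
    using that closed closed_limpt by blast
  moreover have "\<exists>x. C = {x}" if C: "C \<subseteq> measure_support M" "connected C" "C \<noteq> {}" for C
  proof -
    have False if xy: "x \<in> C" "y \<in> C" "x < y" for x y
    proof -
      have "{x..y} \<subseteq> C"
        using C(2) xy(1,2) by (rule connected_contains_Icc)
      then obtain U z where U: "open U" "emeasure M (U \<inter> S) = 0" "z \<in> U" "z \<in> C"
        using null[OF xy(3)] C(1) sub by blast
      then have "z \<in> measure_support M"
        using C(1) by blast
      then have "0 < emeasure M (U \<inter> S)"
        using U(1,3) unfolding measure_support_def space by blast
      then show False
        using U(2) by simp
    qed
    moreover obtain x where "x \<in> C"
      using C(3) by blast
    ultimately have "y = x" if "y \<in> C" for y
      using that by (metis linorder_neqE)
    with \<open>x \<in> C\<close> have "C = {x}"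
      by blast
    then show ?thesis ..
  qed
  ultimately show ?thesis
    unfolding cantor_set_def by blast
qed

section \<open>The invariant measure on the unit interval\<close>

context irrational_rotation
begin

text \<open>\<open>invariant_prob\<close> asks for the Borel sets of \<open>{0..1}\<close>, whereas
  \<open>\<mu>\<close> lives on the whole line.\<close>

definition \<nu> :: "real measure" where
  "\<nu> = restrict_space \<mu> {0..1}"

lemma sets_mu: "sets \<mu> = sets borel"
  by (simp add: \<mu>_def)

lemma sets_nu: "sets \<nu> = sets (restrict_space borel {0..1})"
  by (simp add: \<nu>_def sets_restrict_space sets_mu)

lemma emeasure_nu: "B \<subseteq> {0..1} \<Longrightarrow> emeasure \<nu> B = emeasure \<mu> B"
  unfolding \<nu>_def by (intro emeasure_restrict_space) (auto simp: sets_mu)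

lemma mem_sets_unit_interval:
  "B \<in> sets (restrict_space borel {0..1::real}) \<longleftrightarrow> B \<in> sets borel \<and> B \<subseteq> {0..1}"
  by (auto simp: sets_restrict_space_iff)

lemma dom_subset: "dom \<subseteq> {0..1}"
  by (auto simp: aiet_dom_def)

lemma invariant_prob_nu: "invariant_prob 0 1 D T \<nu>"
  unfolding invariant_prob_def
proof (intro conjI ballI)
  show "sets \<nu> = sets (restrict_space borel {0..1})"
    by (rule sets_nu)
  have "space \<nu> = {0..1}"
    using sets_eq_imp_space_eq[OF sets_nu] by (simp add: space_restrict_space)
  moreover have "mu.prob {0..1} = 1"
    using mu.finite_measure_mono[of dom "{0..1}"] mu.prob_dom mu.prob_le_1[of "{0..1}"] dom_subset by simp
  ultimately show "prob_space \<nu>"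
    by (intro prob_spaceI) (simp add: emeasure_nu mu.emeasure_eq_measure)
  fix B assume "B \<in> sets \<nu>"
  then have B: "B \<in> sets borel" "B \<subseteq> {0..1}"
    unfolding sets_nu mem_sets_unit_interval by auto
  have "{x \<in> dom. T x \<in> B} \<subseteq> {0..1}"
    using dom_subset by blast
  then show "emeasure \<nu> {x \<in> dom. T x \<in> B} = emeasure \<nu> B"
    using emeasure_mu_vimage_T[OF B(1)] B(2) by (simp add: emeasure_nu)
qed

text \<open>Extended by zero to the line, \<open>M\<close> becomes an invariant distribution, hence
  \<open>\<mu>\<close>; restricting again recovers it.\<close>

lemma invariant_prob_unique:
  assumes "invariant_prob 0 1 D T M"
  shows "M = \<nu>"
proof -
  have M: "sets M = sets (restrict_space borel {0..1})" "prob_space M"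
    "\<And>B. B \<in> sets M \<Longrightarrow> emeasure M {x \<in> dom. T x \<in> B} = emeasure M B"
    using assms by (auto simp: invariant_prob_def)
  have space: "space M = {0..1}"
    using sets_eq_imp_space_eq[OF M(1)] by (simp add: space_restrict_space)
  define N where "N = distr M borel (\<lambda>x. x)"
  have meas: "(\<lambda>x. x) \<in> measurable M borel"
    by (subst measurable_cong_sets[OF M(1) refl]) (auto intro: measurable_restrict_space1)
  have N: "emeasure N B = emeasure M (B \<inter> {0..1})" if "B \<in> sets borel" for B
    unfolding N_def using meas that by (subst emeasure_distr) (auto simp: space)
  interpret N: prob_space N
    unfolding N_def using M(2) meas by (rule prob_space.prob_space_distr)
  have "invariant_distribution \<alpha> N"
  proof unfold_locales
    show "sets N = sets borel"
      by (simp add: N_def)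
    fix B :: "real set" assume B: "B \<in> sets borel"
    have Int: "{x \<in> dom. T x \<in> B} = {x \<in> dom. T x \<in> B \<inter> {0..1}}"
      using T_dom_subset by force
    have "emeasure N {x \<in> dom. T x \<in> B} = emeasure M {x \<in> dom. T x \<in> B}"
      using B dom_subset by (subst N) (auto intro!: arg_cong[of _ _ "emeasure M"])
    also have "\<dots> = emeasure M (B \<inter> {0..1})"
      unfolding Int using B by (intro M(3)) (simp add: M(1) mem_sets_unit_interval)
    also have "\<dots> = emeasure N B"
      using B by (simp add: N)
    finally show "N.prob {x \<in> dom. T x \<in> B} = N.prob B"
      by (simp add: measure_def)
  qed
  then have "N = \<mu>"
    by (rule invariant_distribution_unique)
  show ?thesis
  proof (rule measure_eqI)
    show "sets M = sets \<nu>"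
      by (simp add: M(1) sets_nu)
    fix B assume "B \<in> sets M"
    then have B: "B \<in> sets borel" "B \<subseteq> {0..1}"
      unfolding M(1) mem_sets_unit_interval by auto
    then have "emeasure M B = emeasure N B"
      by (simp add: N Int_absorb2)
    also have "\<dots> = emeasure \<nu> B"
      using B by (simp add: \<open>N = \<mu>\<close> emeasure_nu)
    finally show "emeasure M B = emeasure \<nu> B" .
  qed
qed

lemma cantor_support_nu: "cantor_set (measure_support \<nu>)"
proof (rule cantor_set_measure_support[OF sets_nu])
  have nu: "emeasure \<nu> (U \<inter> {0..1}) = 0" if "mu.prob U = 0" "open U" for U
  proof -
    have "mu.prob (U \<inter> {0..1}) \<le> mu.prob U"
      using that by (intro mu.finite_measure_mono) auto
    then have "mu.prob (U \<inter> {0..1}) = 0"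
      using that measure_nonneg[of \<mu> "U \<inter> {0..1}"] by simp
    then show ?thesis
      by (simp add: emeasure_nu mu.emeasure_eq_measure)
  qed
  show "emeasure \<nu> {0..1} \<noteq> 0"
    using prob_space.emeasure_space_1[of \<nu>] invariant_prob_nu sets_eq_imp_space_eq[OF sets_nu]
    by (auto simp: invariant_prob_def space_restrict_space)
  show "emeasure \<nu> {x} = 0" if "x \<in> {0..1}" for x
    using that mu.prob_singleton[of x] by (simp add: emeasure_nu mu.emeasure_eq_measure)
  show "\<exists>U. open U \<and> U \<inter> {x..y} \<noteq> {} \<and> emeasure \<nu> (U \<inter> {0..1}) = 0"
    if xy: "x < y" "{x..y} \<subseteq> {0..1}" for x y
  \<comment> \<open>An interval that starts left of 1/2 meets a gap, any other one meets
    \<open>{1/2<..<1}\<close>; both are null.\<close>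
  proof (cases "x < 1/2")
    case True
    then have "(x + min y (1/2)) / 2 \<in> {x<..<y} \<inter> {0..1/2}"
      using xy by (auto simp: min_def)
    then obtain n where n: "{x<..<y} \<inter> gap n \<noteq> {}"
      using gaps_dense[of "{x<..<y}"] by (metis empty_iff open_greaterThanLessThan)
    then have "gap n \<inter> {x..y} \<noteq> {}"
      by force
    then show ?thesis
      using nu[OF mu.prob_gap open_gap, of n] open_gap by blast
  next
    case False
    then have "(x + y) / 2 \<in> {1/2<..<1} \<inter> {x..y}"
      using xy by (auto simp: field_simps)
    then have "{1/2<..<1} \<inter> {x..y} \<noteq> {}"
      by blast
    then show ?thesis
      using nu[OF mu.prob_right_half open_greaterThanLessThan] open_greaterThanLessThan by blast
  qed
qed simp

lemma uniquely_ergodic_T: "uniquely_ergodic 0 1 D T"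
  unfolding uniquely_ergodic_def using invariant_prob_nu invariant_prob_unique by blast

lemma the_invariant_measure_T: "the_invariant_measure 0 1 D T = \<nu>"
  unfolding the_invariant_measure_def using invariant_prob_nu invariant_prob_unique by (rule the_equality)

end

theorem theoremA:
  shows "\<exists>(D :: real set) (T :: real \<Rightarrow> real).
    AIET 0 1 D T \<and> has_flips 0 1 D T \<and>
    uniquely_ergodic 0 1 D T \<and>
    (\<exists>J. wandering_interval 0 1 D T J) \<and>
    cantor_set (measure_support (the_invariant_measure 0 1 D T))"
proof -
  have "uncountable ({0<..<1::real} - \<rat>)"
    by (intro uncountable_minus_countable countable_rat) (simp add: uncountable_open_interval)
  then obtain \<alpha> :: real where "\<alpha> \<in> {0<..<1} - \<rat>"
    by (metis countable_empty ex_in_conv)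
  then interpret irrational_rotation \<alpha>
    by unfold_locales auto
  show ?thesis
    using AIET_T has_flips_T uniquely_ergodic_T wandering_gap cantor_support_nu
    unfolding the_invariant_measure_T[symmetric] by blast
qed

end
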